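(* Let $p(z)=\sum_{j=0}^{n}a_jz^j$, with $a_0\neq 0$, be a polynomial of degree $n$ with complex coefficients, and write $\alpha_j=\operatorname{Re}(a_j)$ and $\beta_j=\operatorname{Im}(a_j)$ for $0\le j\le n$. Suppose that for some $\lambda\in\{0,1,2,\ldots,n\}$, $$\alpha_{n}\leq \alpha_{n-1}\leq \cdots\leq\alpha_{\lambda}\geq\alpha_{\lambda-1}\geq\alpha_{\lambda-2}\geq\cdots\geq\alpha_{1}\geq\alpha_{0}.$$ Then for every $\delta$ with $0<\delta<1$, the number of zeros of $p$ in the disk $|z|\leq\delta$ does not exceed $$\frac{1}{\log (1/\delta)}\log\frac{M_1}{|a_0|},$$ where $$M_1=|\alpha_0|-\alpha_0+|\alpha_n|-\alpha_n+2\alpha_{\lambda}+2\sum_{j=0}^{n}|\beta_j|.$$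
   Context: Zeros are counted with multiplicity. The displayed chain means that $\alpha_n,\alpha_{n-1},\ldots,\alpha_\lambda$ is nondecreasing and $\alpha_\lambda,\alpha_{\lambda-1},\ldots,\alpha_0$ is nonincreasing (one of the two parts being vacuous if $\lambda=n$ or $\lambda=0$). *)

theory Defs
  imports Complex_Main "HOL-Computational_Algebra.Polynomial"
begin

end

theory Submission
  imports
    Defs
    "HOL-Computational_Algebra.Fundamental_Theorem_Algebra"
    "HOL-Complex_Analysis.Conformal_Mappings"
begin

text \<open>
  The bound is Jensen's inequality for the polynomial \<open>F(z) = (1 - z) p(z)\<close>. The coefficients
  of \<open>F\<close> are \<open>a\<^sub>0\<close>, the consecutive differences \<open>a\<^sub>j - a\<^sub>j\<^sub>-\<^sub>1\<close> and \<open>-a\<^sub>n\<close>, so the monotonicity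
  hypotheses on the real parts turn into cancellation: the sum of the absolute values of the
  differences of the real parts telescopes on each side of the peak index \<open>l\<close>, while the
  imaginary parts are estimated crudely by the triangle inequality. On the unit circle the
  modulus of \<open>F\<close> is at most the sum of the moduli of its coefficients, and this gives \<open>|F| \<le> M\<^sub>1\<close> there.

  It remains to see that many zeros near the origin force \<open>|F(0)| = |a\<^sub>0|\<close> to be small compared
  to \<open>M\<^sub>1\<close>. Replacing a linear factor \<open>z - w\<close> by its reflection \<open>1 - cnj w * z\<close> leaves its
  modulus on the unit circle unchanged, but changes its modulus at the origin from \<open>|w|\<close> to \<open>1\<close>.
  By the maximum modulus principle for the reflected polynomial,
  \<open>|F(0)| \<le> M\<^sub>1 \<Prod>|w|\<close>, where \<open>w\<close> runs over the chosen zeros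
  (lemma \<open>norm_poly_0_le_prod_roots\<close>). With \<open>k\<close> zeros in \<open>|z| \<le> \<delta>\<close> this reads
  \<open>|a\<^sub>0| \<le> M\<^sub>1 \<delta>\<^sup>k\<close>, and taking logarithms yields the theorem.
\<close>

lemma norm_poly_0_le_of_unit_circle:
  fixes p :: "complex poly"
  assumes "\<And>z. cmod z = 1 \<Longrightarrow> cmod (poly p z) \<le> M"
  shows "cmod (poly p 0) \<le> M"
proof (rule maximum_modulus_frontier[where f = "poly p" and S = "cball 0 1"])
  show "poly p holomorphic_on interior (cball 0 1)"
    by (intro holomorphic_intros)
  show "continuous_on (closure (cball 0 1)) (poly p)"
    by (intro continuous_intros)
qed (use assms in auto)

text \<open>
  On the unit circle \<open>1 = z * cnj z\<close>, so \<open>1 - cnj w * z\<close> is \<open>z\<close> times the conjugate of \<open>z - w\<close>.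
\<close>

lemma norm_reflected_factor:
  assumes "cmod z = 1"
  shows "cmod (1 - cnj w * z) = cmod (z - w)"
proof -
  have "z * cnj z = 1"
    using assms complex_norm_square[of z] by simp
  hence "1 - cnj w * z = z * cnj (z - w)"
    by (simp add: algebra_simps)
  thus ?thesis
    using assms by (simp add: norm_mult del: complex_cnj_diff)
qed

text \<open>
  Jensen's inequality for the unit disk. The multiset \<open>A\<close> consists of some of the zeros of \<open>p\<close>,
  with at most their multiplicities; reflecting exactly these zeros gives a polynomial with the
  same modulus on the circle, whose modulus at the origin has lost the factor \<open>\<Prod>|w|\<close>.
\<close>

lemma norm_poly_0_le_prod_roots:
  fixes p :: "complex poly"
  assumes dvd: "(\<Prod>w\<in>#A. [:-w, 1:]) dvd p"
    and bound: "\<And>z. cmod z = 1 \<Longrightarrow> cmod (poly p z) \<le> M"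
  shows "cmod (poly p 0) \<le> M * (\<Prod>w\<in>#A. cmod w)"
proof -
  obtain q where p: "p = (\<Prod>w\<in>#A. [:-w, 1:]) * q"
    using dvd by (elim dvdE)
  define B where "B = (\<Prod>w\<in>#A. [:1, - cnj w:])"
  have circle: "cmod (poly B z) = cmod (poly (\<Prod>w\<in>#A. [:-w, 1:]) z)" if "cmod z = 1" for z
  proof -
    have factor: "cmod (1 - z * cnj w) = cmod (z - w)" for w
      using norm_reflected_factor[OF that, of w] by (simp add: mult.commute)
    show ?thesis
      unfolding B_def
    proof (induction A)
      case (add w A)
      have "cmod (poly [:1, - cnj w:] z) = cmod (poly [:-w, 1:] z)"
        using factor by simp
      thus ?case
        using add.IH by (simp only: image_mset_add_mset prod_mset.add_mset poly_mult norm_mult)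
    qed simp
  qed
  have B0: "poly B 0 = 1"
    unfolding B_def by (induction A) simp_all
  have A0: "cmod (poly (\<Prod>w\<in>#A. [:-w, 1:]) 0) = (\<Prod>w\<in>#A. cmod w)"
    by (induction A) (simp_all add: norm_mult)
  have "cmod (poly (B * q) 0) \<le> M"
  proof (rule norm_poly_0_le_of_unit_circle)
    fix z :: complex
    assume z: "cmod z = 1"
    show "cmod (poly (B * q) z) \<le> M"
      using bound[OF z] circle[OF z] by (simp add: p norm_mult)
  qed
  hence "cmod (poly q 0) \<le> M"
    by (simp add: B0)
  moreover have "0 \<le> (\<Prod>w\<in>#A. cmod w)"
    unfolding A0[symmetric] by (rule norm_ge_zero)
  ultimately show ?thesis
    by (simp add: p norm_mult A0 mult.commute[of M] mult_left_mono)
qed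

lemma prod_mset_le_power_size:
  fixes f :: "'a \<Rightarrow> real"
  assumes "\<And>x. x \<in># A \<Longrightarrow> 0 \<le> f x" "\<And>x. x \<in># A \<Longrightarrow> f x \<le> c"
  shows "0 \<le> prod_mset (image_mset f A) \<and> prod_mset (image_mset f A) \<le> c ^ size A"
  using assms
proof (induction A)
  case (add x A)
  have "0 \<le> f x" "f x \<le> c"
    using add.prems by auto
  moreover have "0 \<le> prod_mset (image_mset f A) \<and> prod_mset (image_mset f A) \<le> c ^ size A"
    using add by auto
  ultimately show ?case
    by (auto intro: mult_mono)
qed simp

lemma size_roots_in_disk_le:
  fixes p :: "complex poly"
  assumes dvd: "(\<Prod>w\<in>#A. [:-w, 1:]) dvd p"
    and bound: "\<And>z. cmod z = 1 \<Longrightarrow> cmod (poly p z) \<le> M"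
    and A: "\<And>w. w \<in># A \<Longrightarrow> cmod w \<le> \<delta>"
    and p0: "poly p 0 \<noteq> 0"
    and \<delta>: "0 < \<delta>" "\<delta> < 1"
  shows "real (size A) \<le> 1 / ln (1 / \<delta>) * ln (M / cmod (poly p 0))"
proof -
  let ?c = "cmod (poly p 0)"
  have c: "0 < ?c"
    using p0 by simp
  have "?c \<le> M"
    by (rule norm_poly_0_le_of_unit_circle[OF bound])
  hence M: "0 < M"
    using c by linarith
  have "?c \<le> M * (\<Prod>w\<in>#A. cmod w)"
    by (rule norm_poly_0_le_prod_roots[OF dvd bound])
  also have "\<dots> \<le> M * \<delta> ^ size A"
    using prod_mset_le_power_size[of A cmod \<delta>] A M by (intro mult_left_mono) auto
  finally have "(1 / \<delta>) ^ size A \<le> M / ?c"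
    using c \<delta> by (simp add: field_simps)
  hence "ln ((1 / \<delta>) ^ size A) \<le> ln (M / ?c)"
    using \<delta> c M by (subst ln_le_cancel_iff) auto
  hence "real (size A) * ln (1 / \<delta>) \<le> ln (M / ?c)"
    using \<delta> by (simp add: ln_realpow)
  moreover have "0 < ln (1 / \<delta>)"
    using \<delta> by simp
  ultimately show ?thesis
    by (simp add: field_simps)
qed

lemma prod_proots_subset_dvd:
  fixes p :: "complex poly"
  assumes "A \<subseteq># proots p"
  shows "(\<Prod>w\<in>#A. [:-w, 1:]) dvd p"
proof -
  have "(\<Prod>w\<in>#A. [:-w, 1:]) dvd (\<Prod>w\<in>#proots p. [:-w, 1:])"
    using assms by (intro prod_mset_subset_imp_dvd image_mset_subseteq_mono)
  also have "\<dots> dvd smult (lead_coeff p) (\<Prod>w\<in>#proots p. [:-w, 1:])"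
    by (rule dvd_smult) simp
  also have "\<dots> = p"
    by (rule complex_poly_decompose_multiset)
  finally show ?thesis .
qed

text \<open>
  The constant term and the term of degree \<open>n + 1\<close> of \<open>(1 - z) p(z)\<close> give the two boundary terms,
  the other terms give the differences.
\<close>

lemma norm_one_minus_times_poly_le:
  fixes p :: "complex poly"
  assumes "cmod z = 1" and n: "degree p = n"
  shows "cmod (poly ([:1, -1:] * p) z) \<le>
    cmod (coeff p 0) + (\<Sum>j<n. cmod (coeff p (Suc j) - coeff p j)) + cmod (coeff p n)"
proof -
  let ?F = "[:1, -1:] * p"
  have F0: "coeff ?F 0 = coeff p 0"
    by simp
  have FSuc: "coeff ?F (Suc j) = coeff p (Suc j) - coeff p j" for j
    by simp
  have "degree ?F \<le> Suc n"
    using degree_mult_le[of "[:1, -1:]" p] n by simp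
  hence "?F = (\<Sum>i\<le>Suc n. monom (coeff ?F i) i)"
    by (rule poly_as_sum_of_monoms'[symmetric])
  hence "poly ?F z = poly (\<Sum>i\<le>Suc n. monom (coeff ?F i) i) z"
    by (rule arg_cong)
  also have "\<dots> = (\<Sum>i\<le>Suc n. coeff ?F i * z ^ i)"
    by (simp only: poly_sum poly_monom)
  finally have "cmod (poly ?F z) \<le> (\<Sum>i\<le>Suc n. cmod (coeff ?F i * z ^ i))"
    by (simp only: norm_sum)
  also have "\<dots> = (\<Sum>i\<le>Suc n. cmod (coeff ?F i))"
    using assms(1) by (simp only: norm_mult norm_power power_one mult_1_right)
  also have "\<dots> = cmod (coeff p 0) + (\<Sum>j\<le>n. cmod (coeff p (Suc j) - coeff p j))"
    by (simp only: sum.atMost_Suc_shift F0 FSuc)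
  also have "(\<Sum>j\<le>n. cmod (coeff p (Suc j) - coeff p j)) =
      (\<Sum>j<n. cmod (coeff p (Suc j) - coeff p j)) + cmod (coeff p n)"
    using n by (simp add: lessThan_Suc_atMost[symmetric] coeff_eq_0)
  finally show ?thesis
    by (simp add: add.assoc)
qed

lemma sum_abs_diff_unimodal:
  fixes \<alpha> :: "nat \<Rightarrow> real"
  assumes "l \<le> n"
    and decreasing: "\<And>j. \<lbrakk>l \<le> j; j < n\<rbrakk> \<Longrightarrow> \<alpha> (Suc j) \<le> \<alpha> j"
    and increasing: "\<And>j. j < l \<Longrightarrow> \<alpha> j \<le> \<alpha> (Suc j)"
  shows "(\<Sum>j<n. \<bar>\<alpha> (Suc j) - \<alpha> j\<bar>) = 2 * \<alpha> l - \<alpha> 0 - \<alpha> n"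
proof -
  have "(\<Sum>j<l. \<bar>\<alpha> (Suc j) - \<alpha> j\<bar>) = (\<Sum>j<l. \<alpha> (Suc j) - \<alpha> j)"
    using increasing by (intro sum.cong) auto
  hence up: "(\<Sum>j<l. \<bar>\<alpha> (Suc j) - \<alpha> j\<bar>) = \<alpha> l - \<alpha> 0"
    by (simp add: sum_lessThan_telescope)
  have "(\<Sum>j=l..<n. \<bar>\<alpha> (Suc j) - \<alpha> j\<bar>) = (\<Sum>j=l..<n. - (\<alpha> (Suc j) - \<alpha> j))"
    using decreasing by (intro sum.cong) auto
  also have "\<dots> = - (\<alpha> n - \<alpha> l)"
    using sum_Suc_diff'[OF \<open>l \<le> n\<close>, of \<alpha>] by (simp only: sum_negf)
  finally have down: "(\<Sum>j=l..<n. \<bar>\<alpha> (Suc j) - \<alpha> j\<bar>) = \<alpha> l - \<alpha> n"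
    by simp
  have "{..<n} = {..<l} \<union> {l..<n}"
    using \<open>l \<le> n\<close> by auto
  thus ?thesis
    using up down by (simp add: sum.union_disjoint ivl_disj_int)
qed

text \<open>Each \<open>|\<beta>\<^sub>j|\<close> occurs twice on the left after the triangle inequality, the outer ones once
  in a difference and once as a boundary term.\<close>

lemma sum_abs_diff_with_ends_le:
  fixes \<beta> :: "nat \<Rightarrow> real"
  shows "\<bar>\<beta> 0\<bar> + (\<Sum>j<n. \<bar>\<beta> (Suc j) - \<beta> j\<bar>) + \<bar>\<beta> n\<bar> \<le> 2 * (\<Sum>j=0..n. \<bar>\<beta> j\<bar>)"
  by (induction n) auto

theorem corollary1:
  fixes p :: "complex poly" and n l :: nat and \<alpha> \<beta> :: "nat \<Rightarrow> real" and M1 \<delta> :: real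
  assumes "degree p = n"
    and "coeff p 0 \<noteq> 0"
    and "\<And>j. j \<le> n \<Longrightarrow> \<alpha> j = Re (coeff p j)"
    and "\<And>j. j \<le> n \<Longrightarrow> \<beta> j = Im (coeff p j)"
    and "l \<le> n"
    and "\<And>j. \<lbrakk>l \<le> j; j < n\<rbrakk> \<Longrightarrow> \<alpha> (Suc j) \<le> \<alpha> j"
    and "\<And>j. j < l \<Longrightarrow> \<alpha> j \<le> \<alpha> (Suc j)"
    and "M1 = \<bar>\<alpha> 0\<bar> - \<alpha> 0 + \<bar>\<alpha> n\<bar> - \<alpha> n + 2 * \<alpha> l + 2 * (\<Sum>j=0..n. \<bar>\<beta> j\<bar>)"
    and "0 < \<delta>" "\<delta> < 1"
  shows "real (size (filter_mset (\<lambda>z. cmod z \<le> \<delta>) (proots p)))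
           \<le> 1 / ln (1 / \<delta>) * ln (M1 / cmod (coeff p 0))"
proof -
  let ?A = "filter_mset (\<lambda>z. cmod z \<le> \<delta>) (proots p)"
  let ?F = "[:1, -1:] * p"
  have F0: "poly ?F 0 = coeff p 0"
    by (simp add: poly_0_coeff_0)
  have "(\<Prod>w\<in>#?A. [:-w, 1:]) dvd p"
    by (rule prod_proots_subset_dvd) (rule multiset_filter_subset)
  hence dvd: "(\<Prod>w\<in>#?A. [:-w, 1:]) dvd ?F"
    by (rule dvd_mult)
  have coeff_le: "cmod (coeff p j) \<le> \<bar>\<alpha> j\<bar> + \<bar>\<beta> j\<bar>" if "j \<le> n" for j
    using cmod_le[of "coeff p j"] assms(3,4)[OF that] by simp
  have diff_le: "cmod (coeff p (Suc j) - coeff p j) \<le>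
      \<bar>\<alpha> (Suc j) - \<alpha> j\<bar> + \<bar>\<beta> (Suc j) - \<beta> j\<bar>" if "j < n" for j
    using cmod_le[of "coeff p (Suc j) - coeff p j"] assms(3,4)[of j] assms(3,4)[of "Suc j"] that
    by simp
  have unimodal: "(\<Sum>j<n. \<bar>\<alpha> (Suc j) - \<alpha> j\<bar>) = 2 * \<alpha> l - \<alpha> 0 - \<alpha> n"
    using assms(5-7) by (rule sum_abs_diff_unimodal)
  have sum_diff_le: "(\<Sum>j<n. cmod (coeff p (Suc j) - coeff p j)) \<le>
      (2 * \<alpha> l - \<alpha> 0 - \<alpha> n) + (\<Sum>j<n. \<bar>\<beta> (Suc j) - \<beta> j\<bar>)"
  proof -
    have "(\<Sum>j<n. cmod (coeff p (Suc j) - coeff p j)) \<le>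
        (\<Sum>j<n. \<bar>\<alpha> (Suc j) - \<alpha> j\<bar> + \<bar>\<beta> (Suc j) - \<beta> j\<bar>)"
      using diff_le by (intro sum_mono) simp
    thus ?thesis
      by (simp add: sum.distrib unimodal)
  qed
  have bound: "cmod (poly ?F z) \<le> M1" if "cmod z = 1" for z
    using norm_one_minus_times_poly_le[OF that assms(1)] coeff_le[of 0] coeff_le[of n]
      sum_diff_le sum_abs_diff_with_ends_le[of \<beta> n] assms(8)
    by linarith
  have "real (size ?A) \<le> 1 / ln (1 / \<delta>) * ln (M1 / cmod (poly ?F 0))"
    by (rule size_roots_in_disk_le[OF dvd bound]) (use assms(2,9,10) F0 in auto)
  thus ?thesis
    by (simp only: F0)
qed

end
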